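(* Let $n\ge 1$, $d\in[n]$, let $\sigma$ be a uniformly random permutation of $n$ elements and let $\phi\in\mathfrak F_d$ be a polynomial map of degree $d$ with non-negative coefficients. Suppose there exist $C_D,C_D',C_U\ge 0$ such that for all integers $k\in[0,d]$, $$\|D^k\phi\|_\infty\le C_D,\qquad \|\nabla D^k\phi\|_\infty\le C_D',\qquad \|D^kU\phi\|_\infty\le C_U.$$ Then for all $t\ge 0$, $$\mathbb P\big[\phi(\sigma)-\mathbb E[\phi]\ge t\big]\le\exp\left(\frac{-t^2}{2(\gamma_\phi+\beta_\phi t)}\right)\quad\text{and}\quad \mathbb P\big[\phi(\sigma)-\mathbb E[\phi]\le -t\big]\le\exp\left(\frac{-t^2}{2\gamma_\phi}\right),$$ where $$\beta_\phi:=9\,d\,C_D'\left(\log\Big(\frac{4C_Dn}{C_D'}\Big)^{+}+\frac{(2/n)(2-e^{-2/n})}{1-e^{-2/n}}\right),\qquad \gamma_\phi:=\frac{2\beta_\phi}{5}\big(2\,\mathbb E[\phi]+C_U\big).$$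
   Context: $[n]=\{1,\dots,n\}$; $\mathfrak S_n$ is the symmetric group on $[n]$. A permutation $\sigma$ is identified with its matrix $S$, $S_{ij}=\mathbf 1_{\sigma(i)=j}$, so a function on $M_n(\mathbb R)$ can be evaluated at $\sigma$. $\partial_{ij}$ is the partial derivative with respect to the entry $(i,j)$. Let $$\mathfrak F=\{\phi:M_n(\mathbb R)\to\mathbb R\ :\ \forall i,j,k\in[n],\ \partial_{ij}\partial_{ik}\phi\equiv\partial_{ji}\partial_{ki}\phi\equiv0\}.$$ These are polynomials in indeterminates $X_{ij}$, $i,j\in[n]$, each of whose monomials contains at most one indeterminate (to the first power) from each row and each column. $\mathfrak F_{=d}$ is the subspace of homogeneous polynomials of degree $d$ in $\mathfrak F$, and $\mathfrak F_d=\bigoplus_{k=0}^d\mathfrak F_{=k}$. Linear operators $D,U$ on $\mathfrak F$ are defined on homogeneous $\phi\in\mathfrak F_{=d}$, $d\ge1$, by $$D\phi=\frac1{dn}\sum_{i,j\in[n]}\partial_{ij}\phi,\qquad U\phi(X)=\frac1{dn}\sum_{i,j,k,l\in[n]}X_{il}X_{kj}\,\partial_{ij}\partial_{kl}\phi(X),$$ with $D\phi=U\phi=0$ for constant $\phi$, and extended by linearity. $\|\phi\|_\infty=\max_{\sigma\in\mathfrak S_n}|\phi(\sigma)|$, $\|\nabla\phi\|_\infty=\max_{\sigma\in\mathfrak S_n}\max_{i,j\in[n]}|\partial_{ij}\phi(\sigma)|$, and $\mathbb E[\phi]=\mathbb E[\phi(\sigma)]$ for $\sigma$ uniform on $\mathfrak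 S_n$. $\log(x)^+$ denotes the positive part of $\log x$. *)

theory Defs
  imports "HOL-Probability.Probability" "HOL-Library.Poly_Mapping"
begin

text \<open>The index set \<open>[n]\<close> is an arbitrary finite type \<open>'n\<close> with \<open>n = CARD('n)\<close>.\<close>

definition perm_matrix :: "('n::finite \<Rightarrow> 'n) \<Rightarrow> real^'n^'n" where
  "perm_matrix \<sigma> = (\<chi> i j. if \<sigma> i = j then 1 else 0)"

abbreviation perms :: "('n::finite \<Rightarrow> 'n) set" where
  "perms \<equiv> {\<sigma>. \<sigma> permutes UNIV}"

definition matrix_unit :: "'n::finite \<Rightarrow> 'n \<Rightarrow> real^'n^'n" where
  "matrix_unit i j = axis i (axis j 1)"

text \<open>\<open>pd i j \<phi>\<close> is \<open>\<partial>\<^sub>i\<^sub>j \<phi>\<close>, the partial derivative with respect to the \<open>(i,j)\<close> entry. As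
  \<^const>\<open>deriv\<close> is unspecified at points of non-differentiability, existence is recorded
  separately in \<open>has_pd\<close>.\<close>

definition has_pd :: "'n::finite \<Rightarrow> 'n \<Rightarrow> (real^'n^'n \<Rightarrow> real) \<Rightarrow> bool" where
  "has_pd i j \<phi> \<longleftrightarrow>
     (\<forall>X. (\<lambda>t. \<phi> (X + t *\<^sub>R matrix_unit i j)) field_differentiable (at 0))"

definition pd :: "'n::finite \<Rightarrow> 'n \<Rightarrow> (real^'n^'n \<Rightarrow> real) \<Rightarrow> real^'n^'n \<Rightarrow> real" where
  "pd i j \<phi> X = deriv (\<lambda>t. \<phi> (X + t *\<^sub>R matrix_unit i j)) 0"

definition FF :: "(real^'n::finite^'n \<Rightarrow> real) set" where
  "FF = {\<phi>. (\<forall>i j. has_pd i j \<phi>) \<and>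
             (\<forall>i j k. has_pd i j (pd i k \<phi>) \<and> has_pd j i (pd k i \<phi>) \<and>
                      (\<forall>X. pd i j (pd i k \<phi>) X = 0) \<and> (\<forall>X. pd j i (pd k i \<phi>) X = 0))}"

text \<open>Polynomials in the indeterminates \<open>X\<^sub>i\<^sub>j\<close>. Since the reals are infinite, a polynomial is
  determined by its polynomial map, so the existential quantifiers below range over at most one
  polynomial.\<close>

type_synonym 'n monomial = "('n \<times> 'n) \<Rightarrow>\<^sub>0 nat"
type_synonym 'n polynomial = "'n monomial \<Rightarrow>\<^sub>0 real"

definition monomial_degree :: "'n::finite monomial \<Rightarrow> nat" where
  "monomial_degree m = (\<Sum>ij\<in>Poly_Mapping.keys m. Poly_Mapping.lookup m ij)"

definition monomial_eval :: "'n::finite monomial \<Rightarrow> real^'n^'n \<Rightarrow> real" where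
  "monomial_eval m X = (\<Prod>(i, j)\<in>Poly_Mapping.keys m. (X $ i $ j) ^ Poly_Mapping.lookup m (i, j))"

definition polynomial_eval :: "'n::finite polynomial \<Rightarrow> real^'n^'n \<Rightarrow> real" where
  "polynomial_eval p X = (\<Sum>m\<in>Poly_Mapping.keys p. Poly_Mapping.lookup p m * monomial_eval m X)"

definition nonneg_coeffs :: "(real^'n::finite^'n \<Rightarrow> real) \<Rightarrow> bool" where
  "nonneg_coeffs \<phi> \<longleftrightarrow> (\<exists>p. \<phi> = polynomial_eval p \<and> (\<forall>m. Poly_Mapping.lookup p m \<ge> 0))"

definition has_degree :: "(real^'n::finite^'n \<Rightarrow> real) \<Rightarrow> nat \<Rightarrow> bool" where
  "has_degree \<phi> d \<longleftrightarrow>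
     (\<exists>p. \<phi> = polynomial_eval p \<and> p \<noteq> 0 \<and> Max (monomial_degree ` Poly_Mapping.keys p) = d)"

definition homogeneous :: "(real^'n::finite^'n \<Rightarrow> real) \<Rightarrow> nat \<Rightarrow> bool" where
  "homogeneous \<phi> d \<longleftrightarrow>
     (\<exists>p. \<phi> = polynomial_eval p \<and> (\<forall>m\<in>Poly_Mapping.keys p. monomial_degree m = d))"

definition FF_eq :: "nat \<Rightarrow> (real^'n::finite^'n \<Rightarrow> real) set" where
  "FF_eq d = {\<phi> \<in> FF. homogeneous \<phi> d}"

definition FF_le :: "nat \<Rightarrow> (real^'n::finite^'n \<Rightarrow> real) set" where
  "FF_le d = {\<phi>. \<exists>\<psi>. (\<forall>k\<le>d. \<psi> k \<in> FF_eq k) \<and> \<phi> = (\<lambda>X. \<Sum>k\<le>d. \<psi> k X)}"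

text \<open>The homogeneous components of an element of \<open>FF\<close>; all degrees occurring in \<open>FF\<close> are at
  most \<open>n\<close>, and the decomposition is unique.\<close>

definition hcomp :: "(real^'n::finite^'n \<Rightarrow> real) \<Rightarrow> nat \<Rightarrow> real^'n^'n \<Rightarrow> real" where
  "hcomp \<phi> = (THE \<psi>. (\<forall>k. \<psi> k \<in> FF_eq k) \<and> (\<forall>k>CARD('n). \<psi> k = (\<lambda>X. 0)) \<and>
                     \<phi> = (\<lambda>X. \<Sum>k\<le>CARD('n). \<psi> k X))"

text \<open>Each operator is first given by its formula on the homogeneous elements of degree \<open>d \<ge> 1\<close>,
  then extended by linearity, with constants sent to \<open>0\<close>.\<close>

definition D_hom :: "nat \<Rightarrow> (real^'n::finite^'n \<Rightarrow> real) \<Rightarrow> real^'n^'n \<Rightarrow> real" where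
  "D_hom d \<phi> X = 1 / (real d * real CARD('n)) * (\<Sum>i\<in>UNIV. \<Sum>j\<in>UNIV. pd i j \<phi> X)"

definition U_hom :: "nat \<Rightarrow> (real^'n::finite^'n \<Rightarrow> real) \<Rightarrow> real^'n^'n \<Rightarrow> real" where
  "U_hom d \<phi> X = 1 / (real d * real CARD('n)) *
     (\<Sum>i\<in>UNIV. \<Sum>j\<in>UNIV. \<Sum>k\<in>UNIV. \<Sum>l\<in>UNIV.
        X $ i $ l * X $ k $ j * pd i j (pd k l \<phi>) X)"

definition D_op :: "(real^'n::finite^'n \<Rightarrow> real) \<Rightarrow> real^'n^'n \<Rightarrow> real" where
  "D_op \<phi> X = (\<Sum>d = 1..CARD('n). D_hom d (hcomp \<phi> d) X)"

definition U_op :: "(real^'n::finite^'n \<Rightarrow> real) \<Rightarrow> real^'n^'n \<Rightarrow> real" where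
  "U_op \<phi> X = (\<Sum>d = 1..CARD('n). U_hom d (hcomp \<phi> d) X)"

definition sup_norm :: "(real^'n::finite^'n \<Rightarrow> real) \<Rightarrow> real" where
  "sup_norm \<phi> = Max ((\<lambda>\<sigma>. \<bar>\<phi> (perm_matrix \<sigma>)\<bar>) ` perms)"

definition grad_sup_norm :: "(real^'n::finite^'n \<Rightarrow> real) \<Rightarrow> real" where
  "grad_sup_norm \<phi> = Max ((\<lambda>(\<sigma>, i, j). \<bar>pd i j \<phi> (perm_matrix \<sigma>)\<bar>) ` (perms \<times> UNIV \<times> UNIV))"

definition unif_perm :: "('n::finite \<Rightarrow> 'n) pmf" where
  "unif_perm = pmf_of_set perms"

definition mean :: "(real^'n::finite^'n \<Rightarrow> real) \<Rightarrow> real" where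
  "mean \<phi> = measure_pmf.expectation unif_perm (\<lambda>\<sigma>. \<phi> (perm_matrix \<sigma>))"

text \<open>The operators agree with their defining formulas on homogeneous elements and are computed
  componentwise on \<open>FF_le d\<close>.\<close>

lemma monomial_eval_scale:
  "monomial_eval m (c *\<^sub>R X) = c ^ monomial_degree m * monomial_eval m X"
  unfolding monomial_eval_def monomial_degree_def
  by (simp add: power_mult_distrib prod.distrib power_sum case_prod_unfold)

lemma homogeneous_scale:
  assumes "homogeneous \<phi> d"
  shows "\<phi> (c *\<^sub>R X) = c ^ d * \<phi> X"
proof -
  obtain p where p: "\<phi> = polynomial_eval p" "\<forall>m\<in>Poly_Mapping.keys p. monomial_degree m = d"
    using assms unfolding homogeneous_def by blast
  show ?thesis
    unfolding p(1) polynomial_eval_def sum_distrib_left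
    by (rule sum.cong) (auto simp: monomial_eval_scale p(2))
qed

lemma homogeneous_decomp_unique:
  assumes "\<And>k. k \<le> N \<Longrightarrow> homogeneous (\<psi> k) k" "\<And>k. k \<le> N \<Longrightarrow> homogeneous (\<psi>' k) k"
    and "\<And>X. (\<Sum>k\<le>N. \<psi> k X) = (\<Sum>k\<le>N. \<psi>' k X)" and "k \<le> N"
  shows "\<psi> k = \<psi>' k"
proof
  fix X
  have "(\<Sum>k\<le>N. \<psi> k X * c ^ k) = (\<Sum>k\<le>N. \<psi>' k X * c ^ k)" for c
  proof -
    have "\<psi> k (c *\<^sub>R X) = \<psi> k X * c ^ k \<and> \<psi>' k (c *\<^sub>R X) = \<psi>' k X * c ^ k" if "k \<le> N" for k
      using homogeneous_scale[OF assms(1)[OF that], of c X]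
        homogeneous_scale[OF assms(2)[OF that], of c X] by (simp add: mult.commute)
    then show ?thesis using assms(3)[of "c *\<^sub>R X"] by simp
  qed
  then have "\<forall>k\<le>N. \<psi> k X = \<psi>' k X"
    using polyfun_eq_coeffs[of "\<lambda>k. \<psi> k X" N "\<lambda>k. \<psi>' k X"] by blast
  then show "\<psi> k X = \<psi>' k X" using assms(4) by blast
qed

lemma hcomp_eqI:
  fixes \<phi> :: "real^'n::finite^'n \<Rightarrow> real"
  assumes "\<And>k. \<psi> k \<in> FF_eq k" "\<And>k. k > CARD('n) \<Longrightarrow> \<psi> k = (\<lambda>X. 0)"
    and "\<phi> = (\<lambda>X. \<Sum>k\<le>CARD('n). \<psi> k X)"
  shows "hcomp \<phi> = \<psi>"
  unfolding hcomp_def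
proof (rule the_equality)
  fix \<psi>'
  assume *: "(\<forall>k. \<psi>' k \<in> FF_eq k) \<and> (\<forall>k>CARD('n). \<psi>' k = (\<lambda>X. 0)) \<and>
    \<phi> = (\<lambda>X. \<Sum>k\<le>CARD('n). \<psi>' k X)"
  show "\<psi>' = \<psi>"
  proof
    fix k
    show "\<psi>' k = \<psi> k"
    proof (cases "k \<le> CARD('n)")
      case True
      have "(\<Sum>k\<le>CARD('n). \<psi>' k X) = (\<Sum>k\<le>CARD('n). \<psi> k X)" for X
        using * assms(3) by metis
      then show ?thesis
        using * assms(1) True
        by (intro homogeneous_decomp_unique[of "CARD('n)"]) (auto simp: FF_eq_def)
    next
      case False
      then show ?thesis using * assms(2)[of k] by simp
    qed
  qed
qed (use assms in auto)

lemma pd_zero: "pd i j (\<lambda>X. 0) = (\<lambda>X. 0)"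
  by (simp add: pd_def fun_eq_iff)

lemma zero_in_FF_eq: "(\<lambda>X. 0) \<in> FF_eq d"
proof -
  have "homogeneous (\<lambda>X::real^'a^'a. 0) d"
    unfolding homogeneous_def by (intro exI[of _ 0]) (auto simp: polynomial_eval_def)
  then show ?thesis by (auto simp: FF_eq_def FF_def has_pd_def pd_zero)
qed

lemma hcomp_homogeneous:
  fixes \<phi> :: "real^'n::finite^'n \<Rightarrow> real"
  assumes "\<phi> \<in> FF_eq d" "d \<le> CARD('n)"
  shows "hcomp \<phi> = (\<lambda>k. if k = d then \<phi> else (\<lambda>X. 0))"
proof (rule hcomp_eqI)
  have "(\<Sum>k\<le>CARD('n). (if k = d then \<phi> else (\<lambda>X. 0)) X)
      = (\<Sum>k\<le>CARD('n). if k = d then \<phi> X else 0)" for X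
    by (intro sum.cong) auto
  then show "\<phi> = (\<lambda>X. \<Sum>k\<le>CARD('n). (if k = d then \<phi> else (\<lambda>X. 0)) X)"
    using assms(2) by (simp add: fun_eq_iff)
qed (use assms zero_in_FF_eq in auto)

lemma D_op_homogeneous:
  fixes \<phi> :: "real^'n::finite^'n \<Rightarrow> real"
  assumes "\<phi> \<in> FF_eq d" "1 \<le> d" "d \<le> CARD('n)"
  shows "D_op \<phi> = D_hom d \<phi>"
proof
  fix X
  have "D_op \<phi> X = (\<Sum>k = 1..CARD('n). if k = d then D_hom d \<phi> X else 0)"
    unfolding D_op_def hcomp_homogeneous[OF assms(1,3)]
    by (intro sum.cong) (auto simp: D_hom_def pd_zero)
  then show "D_op \<phi> X = D_hom d \<phi> X" using assms by simp
qed

lemma U_op_homogeneous: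
  fixes \<phi> :: "real^'n::finite^'n \<Rightarrow> real"
  assumes "\<phi> \<in> FF_eq d" "1 \<le> d" "d \<le> CARD('n)"
  shows "U_op \<phi> = U_hom d \<phi>"
proof
  fix X
  have "U_op \<phi> X = (\<Sum>k = 1..CARD('n). if k = d then U_hom d \<phi> X else 0)"
    unfolding U_op_def hcomp_homogeneous[OF assms(1,3)]
    by (intro sum.cong) (auto simp: U_hom_def pd_zero)
  then show "U_op \<phi> X = U_hom d \<phi> X" using assms by simp
qed

lemma D_U_op_constant:
  fixes \<phi> :: "real^'n::finite^'n \<Rightarrow> real"
  assumes "\<phi> \<in> FF_eq 0"
  shows "D_op \<phi> = (\<lambda>X. 0)" "U_op \<phi> = (\<lambda>X. 0)"
  unfolding D_op_def U_op_def hcomp_homogeneous[OF assms le0]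
  by (auto simp: D_hom_def U_hom_def pd_zero intro!: ext sum.neutral)

lemma D_U_op_decomp:
  fixes \<psi> :: "nat \<Rightarrow> real^'n::finite^'n \<Rightarrow> real"
  assumes "\<And>k. k \<le> d \<Longrightarrow> \<psi> k \<in> FF_eq k" "d \<le> CARD('n)"
  shows "D_op (\<lambda>X. \<Sum>k\<le>d. \<psi> k X) = (\<lambda>X. \<Sum>k = 1..d. D_hom k (\<psi> k) X)"
    and "U_op (\<lambda>X. \<Sum>k\<le>d. \<psi> k X) = (\<lambda>X. \<Sum>k = 1..d. U_hom k (\<psi> k) X)"
proof -
  let ?\<psi> = "\<lambda>k. if k \<le> d then \<psi> k else (\<lambda>X. 0)"
  have eq: "hcomp (\<lambda>X. \<Sum>k\<le>d. \<psi> k X) = ?\<psi>"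
  proof (rule hcomp_eqI)
    show "(\<lambda>X. \<Sum>k\<le>d. \<psi> k X) = (\<lambda>X. \<Sum>k\<le>CARD('n). ?\<psi> k X)"
      by (intro ext sum.mono_neutral_cong_left) (use assms(2) in auto)
  qed (use assms zero_in_FF_eq in auto)
  show "D_op (\<lambda>X. \<Sum>k\<le>d. \<psi> k X) = (\<lambda>X. \<Sum>k = 1..d. D_hom k (\<psi> k) X)"
    unfolding D_op_def eq
    by (intro ext sum.mono_neutral_cong_right) (use assms(2) in \<open>auto simp: D_hom_def pd_zero\<close>)
  show "U_op (\<lambda>X. \<Sum>k\<le>d. \<psi> k X) = (\<lambda>X. \<Sum>k = 1..d. U_hom k (\<psi> k) X)"
    unfolding U_op_def eq
    by (intro ext sum.mono_neutral_cong_right) (use assms(2) in \<open>auto simp: U_hom_def pd_zero\<close>)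
qed

end

theory Submission
  imports Defs
begin

text \<open>
  For \<open>A \<subseteq> [n]\<close> let \<open>E\<^sub>A g\<close> be the average of \<open>g(x p)\<close> over the permutations \<open>p\<close> of \<open>A\<close>. For
  \<open>r \<in> A\<close>, \<open>E\<^sub>A g(x)\<close> is the average over \<open>u \<in> A\<close> of \<open>E\<^bsub>A - {r}\<^esub> g(x (r u))\<close>. Averaging this over
  \<open>r\<close> and inducting on \<open>A\<close> writes \<open>g - E[g]\<close> as a sum of differences along transpositions; as
  multiplication by a transposition preserves the uniform measure and \<open>E\<^sub>A\<close> keeps the Lipschitz
  constant \<open>K\<close> of \<open>g\<close>, this gives
  \<open>E[(g - E[g]) \<psi>] \<le> K/(2n) \<Sum>\<^sub>i\<^sub>k E|\<psi>(\<sigma>) - \<psi>(\<sigma> (i k))|\<close>.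

  Take \<open>g = \<phi>\<close> and \<open>\<psi> = \<plusminus>exp(\<theta> \<phi>)\<close>. By symmetry only the losses of \<open>\<phi>\<close> matter on the right:
  since the coefficients are non-negative, going from \<open>\<sigma>\<close> to \<open>\<sigma> (i k)\<close> costs at most \<open>l\<^sub>i + l\<^sub>k\<close>,
  where \<open>l\<^sub>i\<close> is the partial derivative in the entry \<open>(i, \<sigma>(i))\<close>. Moreover \<open>l\<^sub>i \<le> C\<^sub>D'\<close>, and Euler's
  identity bounds \<open>\<Sum>\<^sub>i l\<^sub>i\<close> by \<open>d \<phi>(\<sigma>)\<close>. The resulting differential inequality for the moment
  generating function, of the form \<open>m' \<le> 4 d C\<^sub>D' \<theta> (m' + E[\<phi>] m)\<close>, is integrated and combined with
  Markov's inequality. It suffices that \<open>\<beta>\<^sub>\<phi> \<ge> 9 d C\<^sub>D'\<close>, which holds because the last summand in the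
  bracket defining \<open>\<beta>\<^sub>\<phi>\<close> is at least \<open>1\<close>.
\<close>

section \<open>Averages over the permutations of a subset\<close>

definition partial_mean :: "'n::finite set \<Rightarrow> (('n \<Rightarrow> 'n) \<Rightarrow> real) \<Rightarrow> ('n \<Rightarrow> 'n) \<Rightarrow> real" where
  "partial_mean A g x = (\<Sum>p | p permutes A. g (x \<circ> p)) / fact (card A)"

lemma transpose_in_perms: "Transposition.transpose i k permutes UNIV"
  by (simp add: permutes_swap_id)

lemma swap_in_perms: "x \<in> perms \<Longrightarrow> x \<circ> Transposition.transpose i k \<in> perms"
  by (auto intro: permutes_compose transpose_in_perms)

lemma comp_transpose_twice: "x \<circ> Transposition.transpose i k \<circ> Transposition.transpose i k = x"
  by (simp add: comp_assoc)

lemma sum_perms_swap: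
  fixes f :: "('n::finite \<Rightarrow> 'n) \<Rightarrow> real"
  shows "(\<Sum>x\<in>perms. f (x \<circ> Transposition.transpose i k)) = (\<Sum>x\<in>perms. f x)"
  using sum_permutations_compose_right[OF transpose_in_perms, of f i k] by simp

lemma partial_mean_singleton: "partial_mean {r} g x = g x"
  by (simp add: partial_mean_def)

lemma partial_mean_UNIV:
  fixes x :: "'n::finite \<Rightarrow> 'n"
  assumes "x \<in> perms"
  shows "partial_mean UNIV g x = (\<Sum>y\<in>perms. g y) / fact CARD('n)"
  using setum_permutations_compose_left[of x UNIV g] assms by (simp add: partial_mean_def)

text \<open>A permutation of \<open>A\<close> factors uniquely as \<open>transpose r u\<close> after
  a permutation of \<open>A - {r}\<close>, where \<open>u\<close> is the image of
  \<open>r\<close>.\<close>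

lemma partial_mean_remove:
  assumes "r \<in> A"
  shows "partial_mean A g x
    = (\<Sum>u\<in>A. partial_mean (A - {r}) g (x \<circ> Transposition.transpose r u)) / real (card A)"
proof -
  have A: "A = insert r (A - {r})" "finite (A - {r})" using assms by auto
  have "(\<Sum>p | p permutes A. g (x \<circ> p)) =
    (\<Sum>u\<in>A. \<Sum>p | p permutes (A - {r}). g (x \<circ> Transposition.transpose r u \<circ> p))"
    using sum_over_permutations_insert[OF A(2), of r "\<lambda>p. g (x \<circ> p)"] A(1) by (simp add: comp_assoc)
  moreover have "card A = Suc (card (A - {r}))"
    using assms by (metis card_Suc_Diff1 finite_class.finite)
  ultimately show ?thesis
    by (simp add: partial_mean_def sum_divide_distrib divide_divide_eq_left mult.commute)
qed

lemma swap_comp_perm: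
  assumes "p permutes A"
  shows "x \<circ> Transposition.transpose i k \<circ> p = x \<circ> p \<circ> Transposition.transpose (inv p i) (inv p k)"
proof -
  have b: "bij p" using assms by (rule permutes_bij)
  have "Transposition.transpose i k (p a) = p (Transposition.transpose (inv p i) (inv p k) a)" for a
    using b by (metis bij_inv_eq_iff transpose_apply_first transpose_apply_other transpose_apply_second)
  then show ?thesis by (auto simp: fun_eq_iff)
qed

text \<open>Moving the transposition past \<open>p\<close> conjugates it into another transposition,
  so each summand still changes by at most \<open>K\<close>.\<close>

lemma partial_mean_lipschitz:
  assumes lip: "\<And>x i k. x \<in> perms \<Longrightarrow> \<bar>g x - g (x \<circ> Transposition.transpose i k)\<bar> \<le> K"
    and x: "x \<in> perms"
  shows "\<bar>partial_mean A g x - partial_mean A g (x \<circ> Transposition.transpose i k)\<bar> \<le> K"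
proof -
  let ?P = "{p. p permutes A}"
  have "\<bar>(\<Sum>p\<in>?P. g (x \<circ> p)) - (\<Sum>p\<in>?P. g (x \<circ> Transposition.transpose i k \<circ> p))\<bar>
    \<le> (\<Sum>p\<in>?P. \<bar>g (x \<circ> p) - g (x \<circ> Transposition.transpose i k \<circ> p)\<bar>)"
    by (simp add: sum_subtractf[symmetric] sum_abs)
  also have "\<dots> \<le> (\<Sum>p\<in>?P. K)"
  proof (rule sum_mono)
    fix p assume "p \<in> ?P"
    then have p: "p permutes A" by simp
    have "x \<circ> p \<in> perms"
      using x permutes_subset[OF p] by (auto intro: permutes_compose)
    then show "\<bar>g (x \<circ> p) - g (x \<circ> Transposition.transpose i k \<circ> p)\<bar> \<le> K"
      unfolding swap_comp_perm[OF p] by (rule lip)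
  qed
  also have "\<dots> = fact (card A) * K"
    by (simp add: card_permutations)
  finally show ?thesis
    by (simp add: partial_mean_def diff_divide_distrib[symmetric] field_simps)
qed

section \<open>Covariance bounded by variation along transpositions\<close>

definition swap_variation :: "(('n::finite \<Rightarrow> 'n) \<Rightarrow> real) \<Rightarrow> 'n \<Rightarrow> 'n \<Rightarrow> real" where
  "swap_variation \<psi> i k = (\<Sum>x\<in>perms. \<bar>\<psi> x - \<psi> (x \<circ> Transposition.transpose i k)\<bar>)"

text \<open>The swap permutes \<open>perms\<close>; averaging the sum with its swapped form replaces
  \<open>\<psi> x\<close> by half the difference of \<open>\<psi>\<close>, hence the factor
  1/2.\<close>

lemma sum_diff_mult_le_swap_variation:
  assumes lip: "\<And>x. x \<in> perms \<Longrightarrow> \<bar>g x - g (x \<circ> Transposition.transpose i k)\<bar> \<le> K"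
  shows "(\<Sum>x\<in>perms. (g x - g (x \<circ> Transposition.transpose i k)) * \<psi> x) \<le> K / 2 * swap_variation \<psi> i k"
proof -
  let ?s = "\<lambda>x. x \<circ> Transposition.transpose i k"
  let ?S = "\<Sum>x\<in>perms. (g x - g (?s x)) * \<psi> x"
  have "?S = (\<Sum>x\<in>perms. (g (?s x) - g x) * \<psi> (?s x))"
    using sum_perms_swap[of "\<lambda>x. (g x - g (?s x)) * \<psi> x" i k] by (simp add: comp_transpose_twice)
  then have "2 * ?S = ?S + (\<Sum>x\<in>perms. (g (?s x) - g x) * \<psi> (?s x))" by simp
  also have "\<dots> = (\<Sum>x\<in>perms. (g x - g (?s x)) * (\<psi> x - \<psi> (?s x)))"
    unfolding sum.distrib[symmetric] by (intro sum.cong refl) (simp add: algebra_simps)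
  also have "\<dots> \<le> (\<Sum>x\<in>perms. K * \<bar>\<psi> x - \<psi> (?s x)\<bar>)"
  proof (rule sum_mono)
    fix x :: "'a \<Rightarrow> 'a" assume "x \<in> perms"
    have "(g x - g (?s x)) * (\<psi> x - \<psi> (?s x)) \<le> \<bar>g x - g (?s x)\<bar> * \<bar>\<psi> x - \<psi> (?s x)\<bar>"
      by (metis abs_ge_self abs_mult)
    also have "\<dots> \<le> K * \<bar>\<psi> x - \<psi> (?s x)\<bar>"
      using lip[OF \<open>x \<in> perms\<close>] by (rule mult_right_mono) simp
    finally show "(g x - g (?s x)) * (\<psi> x - \<psi> (?s x)) \<le> K * \<bar>\<psi> x - \<psi> (?s x)\<bar>" .
  qed
  finally have "2 * ?S \<le> K * swap_variation \<psi> i k"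
    by (simp only: swap_variation_def sum_distrib_left)
  then show ?thesis by simp
qed

lemma swap_variation_self: "swap_variation \<psi> i i = 0"
  by (simp add: swap_variation_def)

lemma swap_variation_nonneg: "swap_variation \<psi> i k \<ge> 0"
  by (simp add: swap_variation_def sum_nonneg)

text \<open>A pair of distinct elements survives the removal of \<open>r\<close> for
  \<open>card A - 2\<close> choices of \<open>r\<close>; the diagonal contributes nothing.\<close>

lemma sum_pairs_remove:
  fixes V :: "'a \<Rightarrow> 'a \<Rightarrow> real"
  assumes "finite A" "\<And>i. V i i = 0"
  shows "(\<Sum>r\<in>A. \<Sum>i\<in>A - {r}. \<Sum>k\<in>A - {r}. V i k) = (real (card A) - 2) * (\<Sum>i\<in>A. \<Sum>k\<in>A. V i k)"
proof -
  have "(\<Sum>i\<in>A - {r}. \<Sum>k\<in>A - {r}. V i k)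
      = (\<Sum>i\<in>A. \<Sum>k\<in>A. V i k) - (\<Sum>i\<in>A. V i r) - (\<Sum>k\<in>A. V r k)" if "r \<in> A" for r
    using that assms by (simp add: sum_diff1 sum_subtractf)
  then have "(\<Sum>r\<in>A. \<Sum>i\<in>A - {r}. \<Sum>k\<in>A - {r}. V i k)
      = real (card A) * (\<Sum>i\<in>A. \<Sum>k\<in>A. V i k) - (\<Sum>r\<in>A. \<Sum>i\<in>A. V i r) - (\<Sum>r\<in>A. \<Sum>k\<in>A. V r k)"
    by (simp add: sum_subtractf)
  also have "(\<Sum>r\<in>A. \<Sum>i\<in>A. V i r) = (\<Sum>i\<in>A. \<Sum>k\<in>A. V i k)" by (rule sum.swap)
  finally show ?thesis by (simp add: algebra_simps)
qed

lemma covariance_partial_mean_le: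
  fixes g \<psi> :: "('n::finite \<Rightarrow> 'n) \<Rightarrow> real"
  assumes lip: "\<And>x i k. x \<in> perms \<Longrightarrow> \<bar>g x - g (x \<circ> Transposition.transpose i k)\<bar> \<le> K"
    and "A \<noteq> {}"
  shows "(\<Sum>x\<in>perms. (g x - partial_mean A g x) * \<psi> x)
    \<le> K / (2 * real (card A)) * (\<Sum>i\<in>A. \<Sum>k\<in>A. swap_variation \<psi> i k)"
  using \<open>A \<noteq> {}\<close>
proof (induction "card A" arbitrary: A rule: less_induct)
  case less
  have fin: "finite A" by simp
  let ?L = "\<lambda>A. \<Sum>x\<in>perms. (g x - partial_mean A g x) * \<psi> x"
  let ?V = "swap_variation \<psi>"
  let ?T = "\<lambda>A. \<Sum>i\<in>A. \<Sum>k\<in>A. ?V i k"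
  let ?s = "real (card A)"
  have "K \<ge> 0" using lip[of id undefined undefined] by (simp add: permutes_id)
  have T0: "?T A \<ge> 0" by (intro sum_nonneg swap_variation_nonneg)
  show ?case
  proof (cases "card A = 1")
    case True
    then obtain r where "A = {r}" by (meson card_1_singletonE)
    then show ?thesis by (simp add: partial_mean_singleton swap_variation_self)
  next
    case False
    have "card A \<noteq> 0" using less.prems by simp
    then have s: "?s \<ge> 2" using False by linarith
    have step: "?L A \<le> K / (2 * (?s - 1)) * ?T (A - {r}) + K / (2 * ?s) * (\<Sum>u\<in>A. ?V r u)"
      if r: "r \<in> A" for r
    proof -
      let ?G = "partial_mean (A - {r}) g"
      have c: "card (A - {r}) = card A - 1" using r by simp
      then have c': "real (card (A - {r})) = ?s - 1" using s by linarith
      have "card (A - {r}) \<noteq> 0" using c s by linarith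
      then have "A - {r} \<noteq> {}" by auto
      then have IH: "?L (A - {r}) \<le> K / (2 * (?s - 1)) * ?T (A - {r})"
        using less.hyps[of "A - {r}"] c s unfolding c'[symmetric] by linarith
      \<comment> \<open>Telescoping through \<open>?G\<close>: the first difference falls under the
        induction hypothesis, the second averages over transpositions moving \<open>r\<close>, along
        which \<open>?G\<close> keeps the constant \<open>K\<close>.\<close>
      have pw: "g x - partial_mean A g x
          = g x - ?G x + (\<Sum>u\<in>A. ?G x - ?G (x \<circ> Transposition.transpose r u)) / ?s" for x
        using less.prems by (simp add: partial_mean_remove[OF r, of g x] sum_subtractf diff_divide_distrib)
      have "(\<Sum>x\<in>perms. ((\<Sum>u\<in>A. ?G x - ?G (x \<circ> Transposition.transpose r u)) / ?s) * \<psi> x)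
          = (\<Sum>x\<in>perms. \<Sum>u\<in>A. (?G x - ?G (x \<circ> Transposition.transpose r u)) * \<psi> x / ?s)"
        by (simp add: sum_distrib_right sum_divide_distrib)
      also have "\<dots> = (\<Sum>u\<in>A. \<Sum>x\<in>perms. (?G x - ?G (x \<circ> Transposition.transpose r u)) * \<psi> x / ?s)"
        by (rule sum.swap)
      also have "\<dots> = (\<Sum>u\<in>A. \<Sum>x\<in>perms. (?G x - ?G (x \<circ> Transposition.transpose r u)) * \<psi> x) / ?s"
        by (simp add: sum_divide_distrib)
      also have "\<dots> \<le> (\<Sum>u\<in>A. K / 2 * ?V r u) / ?s"
        by (intro divide_right_mono sum_mono sum_diff_mult_le_swap_variation
            partial_mean_lipschitz lip) auto
      also have "\<dots> = K / (2 * ?s) * (\<Sum>u\<in>A. ?V r u)"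
        unfolding sum_distrib_left[symmetric] by simp
      finally have "(\<Sum>x\<in>perms. ((\<Sum>u\<in>A. ?G x - ?G (x \<circ> Transposition.transpose r u)) / ?s) * \<psi> x)
          \<le> K / (2 * ?s) * (\<Sum>u\<in>A. ?V r u)" .
      with IH show ?thesis by (simp add: pw ring_distribs sum.distrib)
    qed
    \<comment> \<open>Summing over all \<open>r\<close> restores the symmetry between the pairs of
      \<open>A\<close>, which a single \<open>r\<close> breaks.\<close>
    have "?s * ?L A \<le> (\<Sum>r\<in>A. K / (2 * (?s - 1)) * ?T (A - {r}) + K / (2 * ?s) * (\<Sum>u\<in>A. ?V r u))"
      using sum_mono[OF step] by simp
    also have "\<dots> = K / (2 * (?s - 1)) * ((?s - 2) * ?T A) + K / (2 * ?s) * ?T A"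
      unfolding sum.distrib sum_distrib_left[symmetric]
      using sum_pairs_remove[OF fin, of ?V] by (simp add: swap_variation_self)
    also have "\<dots> = K / 2 * ?T A * ((?s - 2) / (?s - 1) + 1 / ?s)"
    proof -
      have "K / (2 * q) * (p * T) + K / (2 * s) * T = K / 2 * T * (p / q + 1 / s)" for p q s T
        by (simp add: distrib_left mult_ac)
      then show ?thesis .
    qed
    also have "\<dots> \<le> K / 2 * ?T A * 1"
    proof (rule mult_left_mono)
      \<comment> \<open>The left side falls short of 1 by exactly
        \<open>1 / (?s * (?s - 1))\<close>, so the constant does not grow along the
        induction.\<close>
      show "(?s - 2) / (?s - 1) + 1 / ?s \<le> 1"
        using s by (auto simp: divide_simps) (auto simp: algebra_simps)
      show "0 \<le> K / 2 * ?T A" using \<open>K \<ge> 0\<close> T0 by simp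
    qed
    finally have bound: "?s * ?L A \<le> K / 2 * ?T A * 1" .
    have "?s > 0" using s by linarith
    from pos_le_divide_eq[OF this] bound have "?L A \<le> K / 2 * ?T A * 1 / ?s"
      by (simp only: mult.commute[of "?L A"])
    then show ?thesis by simp
  qed
qed

lemma card_perms: "card (perms :: ('n::finite \<Rightarrow> 'n) set) = fact CARD('n)"
  by (simp add: card_permutations)

definition perm_mean :: "(('n::finite \<Rightarrow> 'n) \<Rightarrow> real) \<Rightarrow> real" where
  "perm_mean g = (\<Sum>x\<in>perms. g x) / fact CARD('n)"

lemma covariance_le:
  fixes g \<psi> :: "('n::finite \<Rightarrow> 'n) \<Rightarrow> real"
  assumes "\<And>x i k. x \<in> perms \<Longrightarrow> \<bar>g x - g (x \<circ> Transposition.transpose i k)\<bar> \<le> K"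
  shows "(\<Sum>x\<in>perms. (g x - perm_mean g) * \<psi> x)
    \<le> K / (2 * real CARD('n)) * (\<Sum>i\<in>UNIV. \<Sum>k\<in>UNIV. swap_variation \<psi> i k)"
  using covariance_partial_mean_le[OF assms, of UNIV \<psi>]
  by (simp add: partial_mean_UNIV perm_mean_def)

section \<open>Covariance bounds from one-sided losses\<close>

text \<open>\<open>h x\<close> and \<open>l x i\<close> abstract \<open>\<phi>\<close> and its partial derivative in the entry \<open>(i, x i)\<close>, both at
  the permutation matrix of \<open>x\<close>. Non-negative coefficients allow the decrease of \<open>\<phi>\<close> along a
  transposition to be controlled by these partial derivatives alone; the increase involves others.\<close>

locale swap_loss =
  fixes h :: "('n::finite \<Rightarrow> 'n) \<Rightarrow> real" and l :: "('n \<Rightarrow> 'n) \<Rightarrow> 'n \<Rightarrow> real" and C d :: real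
  assumes h_nonneg: "x \<in> perms \<Longrightarrow> h x \<ge> 0"
    and loss: "x \<in> perms \<Longrightarrow> h x - h (x \<circ> Transposition.transpose i k) \<le> l x i + l x k"
    and l_nonneg: "x \<in> perms \<Longrightarrow> l x i \<ge> 0"
    and l_le: "x \<in> perms \<Longrightarrow> l x i \<le> C"
    and sum_l_le: "x \<in> perms \<Longrightarrow> (\<Sum>i\<in>UNIV. l x i) \<le> d * h x"
    and C_pos: "C > 0" and d_pos: "d > 0"
begin

lemma h_lipschitz:
  assumes x: "x \<in> perms"
  shows "\<bar>h x - h (x \<circ> Transposition.transpose i k)\<bar> \<le> 2 * C"
  using loss[OF x, of i k] loss[OF swap_in_perms[OF x], of i k i k] l_le[OF x, of i] l_le[OF x, of k]
    l_le[OF swap_in_perms[OF x], of i k i] l_le[OF swap_in_perms[OF x], of i k k]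
  by (simp add: comp_transpose_twice)

text \<open>The swap is an involution preserving the sum, so increases and decreases of
  \<open>\<psi>\<close> have the same total. Twice the decreases, which \<open>dec\<close> controls,
  therefore give the whole variation.\<close>

lemma swap_variation_le:
  assumes "\<And>x. x \<in> perms \<Longrightarrow> w x \<ge> 0"
    and dec: "\<And>x. x \<in> perms \<Longrightarrow>
      \<psi> x - \<psi> (x \<circ> Transposition.transpose i k) \<le> w x * (l x i + l x k)"
  shows "swap_variation \<psi> i k \<le> 2 * (\<Sum>x\<in>perms. w x * (l x i + l x k))"
proof -
  let ?s = "\<lambda>x. x \<circ> Transposition.transpose i k"
  let ?m = "\<lambda>x. max 0 (\<psi> x - \<psi> (?s x))"
  have "\<bar>\<psi> x - \<psi> (?s x)\<bar> = ?m x + ?m (?s x)" for x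
    by (simp add: comp_transpose_twice)
  then have "swap_variation \<psi> i k = (\<Sum>x\<in>perms. ?m x) + (\<Sum>x\<in>perms. ?m (?s x))"
    by (simp add: swap_variation_def sum.distrib)
  also have "\<dots> = 2 * (\<Sum>x\<in>perms. ?m x)"
    using sum_perms_swap[of ?m i k] by simp
  also have "\<dots> \<le> 2 * (\<Sum>x\<in>perms. w x * (l x i + l x k))"
    by (intro mult_left_mono sum_mono max.boundedI dec mult_nonneg_nonneg add_nonneg_nonneg
        l_nonneg assms(1)) auto
  finally show ?thesis .
qed

text \<open>Here \<open>w\<close> bounds the slope of \<open>\<psi>\<close> as a function of
  \<open>h\<close>. The constant collects the Lipschitz constant \<open>2 * C\<close>, the doubling
  in \<open>swap_variation_le\<close>, and the \<open>2 * n\<close> occurrences of each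
  \<open>l x i\<close> in the double sum.\<close>

lemma covariance_le_loss:
  assumes w: "\<And>x. x \<in> perms \<Longrightarrow> w x \<ge> 0"
    and dec: "\<And>x i k. x \<in> perms \<Longrightarrow>
      \<psi> x - \<psi> (x \<circ> Transposition.transpose i k) \<le> w x * (l x i + l x k)"
  shows "(\<Sum>x\<in>perms. (h x - perm_mean h) * \<psi> x) \<le> 4 * d * C * (\<Sum>x\<in>perms. w x * h x)"
proof -
  let ?n = "real CARD('n)"
  have n: "?n > 0" by simp
  have "(\<Sum>i\<in>UNIV. \<Sum>k\<in>UNIV. swap_variation \<psi> i k)
      \<le> (\<Sum>i\<in>UNIV. \<Sum>k\<in>UNIV. 2 * (\<Sum>x\<in>perms. w x * (l x i + l x k)))"
    by (intro sum_mono swap_variation_le w dec)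
  also have "\<dots> = 2 * (\<Sum>i\<in>UNIV. \<Sum>k\<in>UNIV. \<Sum>x\<in>perms. w x * (l x i + l x k))"
    by (simp add: sum_distrib_left)
  also have "(\<Sum>i\<in>UNIV. \<Sum>k\<in>UNIV. \<Sum>x\<in>perms. w x * (l x i + l x k))
      = (\<Sum>i\<in>UNIV. \<Sum>x\<in>perms. \<Sum>k\<in>UNIV. w x * (l x i + l x k))"
    by (intro sum.cong refl sum.swap)
  also have "\<dots> = (\<Sum>x\<in>perms. \<Sum>i\<in>UNIV. \<Sum>k\<in>UNIV. w x * (l x i + l x k))"
    by (rule sum.swap)
  also have "\<dots> = (\<Sum>x\<in>perms. w x * (2 * ?n * (\<Sum>i\<in>UNIV. l x i)))"
    by (simp add: sum_distrib_left[symmetric] sum.distrib algebra_simps)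
  also have "\<dots> \<le> (\<Sum>x\<in>perms. w x * (2 * ?n * (d * h x)))"
    by (intro sum_mono mult_left_mono w sum_l_le) auto
  also have "\<dots> = 2 * ?n * d * (\<Sum>x\<in>perms. w x * h x)"
    by (simp add: sum_distrib_left mult_ac)
  finally have *: "(\<Sum>i\<in>UNIV. \<Sum>k\<in>UNIV. swap_variation \<psi> i k) \<le> 4 * ?n * d * (\<Sum>x\<in>perms. w x * h x)"
    by simp
  have "(\<Sum>x\<in>perms. (h x - perm_mean h) * \<psi> x)
      \<le> 2 * C / (2 * ?n) * (\<Sum>i\<in>UNIV. \<Sum>k\<in>UNIV. swap_variation \<psi> i k)"
    by (rule covariance_le[OF h_lipschitz])
  also have "\<dots> \<le> 2 * C / (2 * ?n) * (4 * ?n * d * (\<Sum>x\<in>perms. w x * h x))"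
    using * C_pos n by (intro mult_left_mono) auto
  also have "\<dots> = 4 * d * C * (\<Sum>x\<in>perms. w x * h x)"
    using n by (simp add: field_simps)
  finally show ?thesis .
qed

section \<open>Differential inequalities for the moment generating function\<close>

abbreviation "\<mu> \<equiv> perm_mean h"

definition mgf :: "real \<Rightarrow> real" where
  "mgf \<theta> = (\<Sum>x\<in>perms. exp (\<theta> * (h x - \<mu>)))"

definition mgf' :: "real \<Rightarrow> real" where
  "mgf' \<theta> = (\<Sum>x\<in>perms. (h x - \<mu>) * exp (\<theta> * (h x - \<mu>)))"

lemma mgf_deriv: "(mgf has_real_derivative mgf' \<theta>) (at \<theta>)"
  unfolding mgf_def[abs_def] mgf'_def
  by (auto intro!: derivative_eq_intros simp: mult.commute)

lemma mgf_0: "mgf 0 = fact CARD('n)"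
  by (simp add: mgf_def card_perms)

lemma mgf_nonneg: "mgf \<theta> \<ge> 0"
  by (simp add: mgf_def sum_nonneg)

lemma mean_nonneg: "\<mu> \<ge> 0"
  unfolding perm_mean_def by (intro divide_nonneg_nonneg sum_nonneg h_nonneg) auto

lemma sum_centered: "(\<Sum>x\<in>perms. h x - \<mu>) = 0"
  by (simp add: perm_mean_def sum_subtractf card_perms)

lemma sum_h_exp: "(\<Sum>x\<in>perms. h x * exp (\<theta> * (h x - \<mu>))) = mgf' \<theta> + \<mu> * mgf \<theta>"
  by (simp add: mgf_def mgf'_def sum_distrib_left sum.distrib[symmetric] algebra_simps)

text \<open>Convexity of \<open>exp\<close> bounds its decrease by the slope at the starting point
  \<open>x\<close>, where the losses are also measured.\<close>

lemma mgf'_upper: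
  assumes "\<theta> \<ge> 0"
  shows "mgf' \<theta> \<le> \<theta> * (4 * d * C) * (mgf' \<theta> + \<mu> * mgf \<theta>)"
proof -
  let ?e = "\<lambda>x. exp (\<theta> * (h x - \<mu>))"
  have "mgf' \<theta> \<le> 4 * d * C * (\<Sum>x\<in>perms. \<theta> * ?e x * h x)"
    unfolding mgf'_def
  proof (rule covariance_le_loss)
    fix x :: "'n \<Rightarrow> 'n" and i k assume x: "x \<in> perms"
    let ?y = "x \<circ> Transposition.transpose i k"
    have "?e x * (1 + \<theta> * (h ?y - h x)) \<le> ?e x * exp (\<theta> * (h ?y - h x))"
      by (intro mult_left_mono exp_ge_add_one_self) simp
    also have "\<dots> = ?e ?y"
      by (simp add: exp_add[symmetric] algebra_simps)
    finally have "?e x - ?e ?y \<le> \<theta> * ?e x * (h x - h ?y)"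
      by (simp add: algebra_simps)
    also have "\<dots> \<le> \<theta> * ?e x * (l x i + l x k)"
      using assms by (intro mult_left_mono loss x) simp
    finally show "?e x - ?e ?y \<le> \<theta> * ?e x * (l x i + l x k)" .
  qed (use assms in simp)
  also have "\<dots> = \<theta> * (4 * d * C) * (\<Sum>x\<in>perms. h x * ?e x)"
    by (simp add: sum_distrib_left mult_ac)
  finally show ?thesis by (simp add: sum_h_exp)
qed

text \<open>As \<open>h - \<mu>\<close> sums to 0, 1 may be subtracted from the exponential; then
  the factors have opposite signs.\<close>

lemma mgf'_nonpos:
  assumes "\<theta> \<le> 0"
  shows "mgf' \<theta> \<le> 0"
proof -
  have eq: "mgf' \<theta> = (\<Sum>x\<in>perms. (h x - \<mu>) * (exp (\<theta> * (h x - \<mu>)) - 1))"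
    unfolding mgf'_def right_diff_distrib sum_subtractf mult_1_right
    using sum_centered by (simp add: sum_subtractf)
  have "(h x - \<mu>) * (exp (\<theta> * (h x - \<mu>)) - 1) \<le> 0" for x
    using assms by (cases "h x \<ge> \<mu>") (auto simp: mult_le_0_iff zero_le_mult_iff)
  then show ?thesis by (simp add: eq sum_nonpos)
qed

text \<open>Now the exponential is larger at the endpoint \<open>?y\<close>, so convexity would put
  the slope at the wrong end. A second-order bound, valid as \<open>2 * C * s \<le> 1\<close>,
  returns it to \<open>x\<close> at the price \<open>1 + 2 * C * s\<close>.\<close>

lemma mgf'_lower:
  assumes "s \<ge> 0" "2 * C * s \<le> 1"
  shows "- mgf' (- s) \<le> s * (1 + 2 * C * s) * (4 * d * C) * (\<mu> * mgf (- s))"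
proof -
  let ?e = "\<lambda>x. exp (- s * (h x - \<mu>))"
  let ?w = "s * (1 + 2 * C * s)"
  have w0: "?w \<ge> 0" using assms C_pos by simp
  have "(\<Sum>x\<in>perms. (h x - \<mu>) * (- ?e x)) \<le> 4 * d * C * (\<Sum>x\<in>perms. ?w * ?e x * h x)"
  proof (rule covariance_le_loss)
    fix x :: "'n \<Rightarrow> 'n" and i k assume x: "x \<in> perms"
    let ?y = "x \<circ> Transposition.transpose i k"
    let ?u = "s * (l x i + l x k)"
    have l2: "0 \<le> l x i + l x k" "l x i + l x k \<le> 2 * C"
      using l_nonneg[OF x, of i] l_nonneg[OF x, of k] l_le[OF x, of i] l_le[OF x, of k] by auto
    have u: "0 \<le> ?u" "?u \<le> 2 * C * s"
      using l2 assms mult_left_mono[OF l2(2), of s] by (auto simp: mult_ac)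
    have "?e ?y = ?e x * exp (s * (h x - h ?y))"
      by (simp add: exp_add[symmetric] algebra_simps)
    also have "\<dots> \<le> ?e x * exp ?u"
      using loss[OF x, of i k] assms by (intro mult_left_mono) (auto intro: mult_left_mono)
    also have "\<dots> \<le> ?e x * (1 + ?u + ?u\<^sup>2)"
      using u assms(2) by (intro mult_left_mono exp_bound) auto
    also have "\<dots> \<le> ?e x * (1 + ?u + 2 * C * s * ?u)"
      using u by (intro mult_left_mono add_left_mono) (auto simp: power2_eq_square intro: mult_right_mono)
    finally show "- ?e x - - ?e ?y \<le> ?w * ?e x * (l x i + l x k)"
      by (simp add: algebra_simps)
  qed (use w0 in simp)
  also have "(\<Sum>x\<in>perms. ?w * ?e x * h x) = ?w * (\<Sum>x\<in>perms. h x * ?e x)"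
    unfolding sum_distrib_left by (intro sum.cong refl) (simp only: mult_ac)
  also have "4 * d * C * \<dots> = ?w * (4 * d * C) * (\<Sum>x\<in>perms. h x * ?e x)"
    by (simp only: mult_ac)
  \<comment> \<open>The sum is \<open>mgf' (- s) + \<mu> * mgf (- s)\<close>, whose first term is
    non-positive.\<close>
  also have "\<dots> \<le> ?w * (4 * d * C) * (\<mu> * mgf (- s))"
    using mgf'_nonpos[of "- s"] sum_h_exp[of "- s"] assms(1) w0 C_pos d_pos
    by (intro mult_left_mono) auto
  finally show ?thesis by (simp add: mgf'_def sum_negf)
qed

text \<open>A Gronwall argument: \<open>mgf\<close> times \<open>exp\<close> of minus the claimed
  exponent is non-increasing. That exponent is a rational majorant of the exact primitive, which
  would contain a logarithm.\<close>

lemma mgf_upper: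
  assumes \<theta>: "\<theta> \<ge> 0" "4 * d * C * \<theta> < 1"
  shows "mgf \<theta> \<le> fact CARD('n) * exp (4 * d * C * \<mu> * \<theta>\<^sup>2 / (2 * (1 - 4 * d * C * \<theta>)))"
proof -
  define b where "b = 4 * d * C"
  have b: "b > 0" using C_pos d_pos by (simp add: b_def)
  let ?r = "\<lambda>\<theta>. b * \<mu> * \<theta>\<^sup>2 / (2 * (1 - b * \<theta>))"
  let ?r' = "\<lambda>\<theta>. b * \<mu> * \<theta> * (2 - b * \<theta>) / (2 * (1 - b * \<theta>)\<^sup>2)"
  let ?f = "\<lambda>\<theta>. mgf \<theta> * exp (- ?r \<theta>)"
  have "?f \<theta> \<le> ?f 0"
  proof (rule DERIV_nonpos_imp_nonincreasing[OF \<theta>(1)])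
    fix x assume x: "0 \<le> x" "x \<le> \<theta>"
    have "b * x \<le> b * \<theta>" using b x by simp
    then have bx: "1 - b * x > 0" using \<theta>(2) by (simp add: b_def)
    have "(?r has_real_derivative
        ((b * \<mu> * (2 * x)) * (2 * (1 - b * x)) - (b * \<mu> * x\<^sup>2) * (2 * (0 - b))) / (2 * (1 - b * x))\<^sup>2) (at x)"
      using bx by (auto intro!: derivative_eq_intros simp: power2_eq_square)
    also have "(b * \<mu> * (2 * x)) * (2 * (1 - b * x)) - (b * \<mu> * x\<^sup>2) * (2 * (0 - b))
        = 2 * (b * \<mu> * x * (2 - b * x))"
      by (simp add: algebra_simps power2_eq_square)
    also have "2 * (b * \<mu> * x * (2 - b * x)) / (2 * (1 - b * x))\<^sup>2 = ?r' x"
      by (simp only: power_mult_distrib) simp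
    finally have dr: "(?r has_real_derivative ?r' x) (at x)" .
    have df: "(?f has_real_derivative (mgf' x * exp (- ?r x) + (exp (- ?r x) * - ?r' x) * mgf x)) (at x)"
      by (rule DERIV_mult[OF mgf_deriv DERIV_fun_exp[OF DERIV_minus[OF dr]]])
    have "mgf' x * (1 - b * x) \<le> b * \<mu> * x * mgf x"
      using mgf'_upper[OF x(1)] by (simp add: b_def algebra_simps)
    then have "mgf' x \<le> b * \<mu> * x * mgf x / (1 - b * x)"
      using bx by (simp add: field_simps)
    also have "\<dots> = mgf x * (b * \<mu> * x * (2 * (1 - b * x)) / (2 * (1 - b * x)\<^sup>2))"
    proof -
      have "y * z / q = z * (y * (2 * q) / (2 * q\<^sup>2))" if "q > 0" for q y z :: real
        using that by (simp add: power2_eq_square)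
      then show ?thesis using bx .
    qed
    \<comment> \<open>This is \<open>2 * (1 - b * x) \<le> 2 - b * x\<close>.\<close>
    also have "\<dots> \<le> mgf x * ?r' x"
      using bx b x mean_nonneg mgf_nonneg
      by (intro mult_left_mono divide_right_mono) (auto intro!: mult_nonneg_nonneg)
    finally have "mgf' x - mgf x * ?r' x \<le> 0" by simp
    then have "(mgf' x - mgf x * ?r' x) * exp (- ?r x) \<le> 0"
      by (intro mult_nonpos_nonneg) auto
    then show "\<exists>y. (?f has_real_derivative y) (at x) \<and> y \<le> 0"
      using df by (auto intro!: exI simp: algebra_simps)
  qed
  then have "?f \<theta> * exp (?r \<theta>) \<le> ?f 0 * exp (?r \<theta>)" by (intro mult_right_mono) auto
  then show ?thesis by (simp add: mgf_0 b_def exp_minus field_simps)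
qed

text \<open>The constant \<open>7.2 = 4/5 * 9\<close> is what \<open>9 * d * C \<le> \<beta>\<close> leaves of \<open>\<gamma> \<ge> 4/5 * \<beta> * \<mu>\<close>. The range
  of \<open>s\<close> suffices because the lower tail is empty beyond \<open>\<mu>\<close>.\<close>

lemma mgf_lower:
  assumes s: "s \<ge> 0" "7.2 * d * C * s \<le> 1" and d: "d \<ge> 1"
  shows "mgf (- s) \<le> fact CARD('n) * exp (7.2 * d * C * \<mu> * s\<^sup>2 / 2)"
proof -
  define b where "b = 7.2 * d * C"
  let ?f = "\<lambda>s. mgf (- s) * exp (- (b * \<mu> * s\<^sup>2 / 2))"
  have "?f s \<le> ?f 0"
  proof (rule DERIV_nonpos_imp_nonincreasing[OF s(1)])
    fix x assume x: "0 \<le> x" "x \<le> s"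
    have "C * x \<le> C * s" using x C_pos by simp
    also have "\<dots> \<le> d * (C * s)" using d C_pos s mult_right_mono[of 1 d "C * s"] by simp
    finally have Cx: "7.2 * (C * x) \<le> 1" using s(2) by (simp add: mult_ac)
    have df: "(?f has_real_derivative
        ((- mgf' (- x)) * exp (- (b * \<mu> * x\<^sup>2 / 2)) + mgf (- x) * (exp (- (b * \<mu> * x\<^sup>2 / 2)) * - (b * \<mu> * x)))) (at x)"
      by (auto intro!: derivative_eq_intros DERIV_chain'[OF _ mgf_deriv])
    have "- mgf' (- x) \<le> x * (1 + 2 * C * x) * (4 * d * C) * (\<mu> * mgf (- x))"
      using x Cx C_pos by (intro mgf'_lower) auto
    also have "\<dots> = (1 + 2 * C * x) * 4 * (x * d * C * \<mu> * mgf (- x))"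
      by (simp add: mult_ac)
    \<comment> \<open>By \<open>Cx\<close> the factor is at most \<open>4 * (1 + 2 / 7.2)\<close>,
      about 5.1.\<close>
    also have "\<dots> \<le> 7.2 * (x * d * C * \<mu> * mgf (- x))"
      using Cx x d C_pos mean_nonneg mgf_nonneg by (intro mult_right_mono) auto
    finally have "- mgf' (- x) - mgf (- x) * (b * \<mu> * x) \<le> 0" by (simp add: b_def mult_ac)
    then have "(- mgf' (- x) - mgf (- x) * (b * \<mu> * x)) * exp (- (b * \<mu> * x\<^sup>2 / 2)) \<le> 0"
      by (intro mult_nonpos_nonneg) auto
    then show "\<exists>y. (?f has_real_derivative y) (at x) \<and> y \<le> 0"
      using df by (auto intro!: exI simp: algebra_simps)
  qed
  then have "?f s * exp (b * \<mu> * s\<^sup>2 / 2) \<le> ?f 0 * exp (b * \<mu> * s\<^sup>2 / 2)"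
    by (intro mult_right_mono) auto
  then show ?thesis by (simp add: mgf_0 b_def exp_minus field_simps)
qed

section \<open>Tail bounds by Markov's inequality\<close>

lemma chernoff: "real (card {x \<in> perms. \<theta> * (h x - \<mu>) \<ge> a}) * exp a \<le> mgf \<theta>"
proof -
  have "real (card {x \<in> perms. \<theta> * (h x - \<mu>) \<ge> a}) * exp a
      = (\<Sum>x\<in>{x \<in> perms. \<theta> * (h x - \<mu>) \<ge> a}. exp a)" by simp
  also have "\<dots> \<le> (\<Sum>x\<in>{x \<in> perms. \<theta> * (h x - \<mu>) \<ge> a}. exp (\<theta> * (h x - \<mu>)))"
    by (intro sum_mono) auto
  also have "\<dots> \<le> mgf \<theta>"
    unfolding mgf_def by (intro sum_mono2) auto
  finally show ?thesis .
qed

lemma upper_tail: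
  assumes t: "t \<ge> 0" and \<beta>: "9 * d * C \<le> \<beta>" and \<gamma>: "4 / 5 * \<beta> * \<mu> \<le> \<gamma>"
  shows "real (card {x \<in> perms. h x - \<mu> \<ge> t}) / fact CARD('n) \<le> exp (- t\<^sup>2 / (2 * (\<gamma> + \<beta> * t)))"
proof (cases "t = 0")
  case True
  have "card {x \<in> perms. h x - \<mu> \<ge> t} \<le> fact CARD('n)"
    unfolding card_perms[symmetric] by (intro card_mono) auto
  then show ?thesis using True
    by (simp add: divide_le_eq) (metis of_nat_fact of_nat_le_iff)
next
  case False
  then have t: "t > 0" using t by simp
  define b where "b = 4 * d * C"
  have b0: "b > 0" using C_pos d_pos by (simp add: b_def)
  have b': "9 / 4 * b \<le> \<beta>" using \<beta> by (simp add: b_def mult_ac)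
  then have b: "b < \<beta>" using b0 by linarith
  have "b * \<mu> \<le> 4 / 5 * \<beta> * \<mu>"
    using b' b0 by (intro mult_right_mono mean_nonneg) linarith
  then have g: "b * \<mu> \<le> \<gamma>" using \<gamma> by simp
  have \<gamma>0: "\<gamma> \<ge> 0" using g b0 mean_nonneg by (meson mult_nonneg_nonneg less_imp_le order_trans)
  define N where "N = \<gamma> + \<beta> * t"
  have bt: "b * t < \<beta> * t" using b t by simp
  have Nb: "N - b * t > 0" "b * \<mu> \<le> N - b * t" using bt g \<gamma>0 by (auto simp: N_def)
  have N: "N > 0" using Nb b0 t by (smt (verit) mult_pos_pos)
  define \<theta> where "\<theta> = t / N"
  have \<theta>: "\<theta> > 0" using t N by (simp add: \<theta>_def)
  have b\<theta>: "1 - b * \<theta> = (N - b * t) / N" using N by (simp add: \<theta>_def field_simps)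
  then have b\<theta>1: "b * \<theta> < 1" using Nb N by (smt (verit) divide_pos_pos)
  have "{x \<in> perms. h x - \<mu> \<ge> t} = {x \<in> perms. \<theta> * (h x - \<mu>) \<ge> \<theta> * t}"
    using \<theta> by simp
  then have "real (card {x \<in> perms. h x - \<mu> \<ge> t}) * exp (\<theta> * t)
      \<le> fact CARD('n) * exp (b * \<mu> * \<theta>\<^sup>2 / (2 * (1 - b * \<theta>)))"
    using chernoff[of "\<theta> * t" \<theta>] mgf_upper[of \<theta>] \<theta> b\<theta>1 by (simp add: b_def)
  then have "real (card {x \<in> perms. h x - \<mu> \<ge> t}) / fact CARD('n)
      \<le> exp (b * \<mu> * \<theta>\<^sup>2 / (2 * (1 - b * \<theta>)) - \<theta> * t)"
    by (simp add: exp_diff field_simps)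
  also have "b * \<mu> * \<theta>\<^sup>2 / (2 * (1 - b * \<theta>)) = b * \<mu> / (N - b * t) * (t\<^sup>2 / (2 * N))"
    unfolding b\<theta> using N Nb by (simp add: \<theta>_def field_simps power2_eq_square)
  also have "exp (b * \<mu> / (N - b * t) * (t\<^sup>2 / (2 * N)) - \<theta> * t) \<le> exp (1 * (t\<^sup>2 / (2 * N)) - \<theta> * t)"
    using N Nb unfolding exp_le_cancel_iff by (intro diff_right_mono mult_right_mono) auto
  also have "1 * (t\<^sup>2 / (2 * N)) - \<theta> * t = - t\<^sup>2 / (2 * N)"
    using N by (simp add: \<theta>_def field_simps power2_eq_square)
  finally show ?thesis by (simp add: N_def)
qed

lemma lower_tail:
  assumes t: "t \<ge> 0" and d: "d \<ge> 1" and \<beta>: "9 * d * C \<le> \<beta>" and \<gamma>: "4 / 5 * \<beta> * \<mu> \<le> \<gamma>"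
  shows "real (card {x \<in> perms. h x - \<mu> \<le> - t}) / fact CARD('n) \<le> exp (- t\<^sup>2 / (2 * \<gamma>))"
proof (cases "t = 0 \<or> \<gamma> = 0")
  \<comment> \<open>If \<open>\<gamma> = 0\<close>, division by zero makes the exponent 0, so the
    bound is 1.\<close>
  case True
  have "card {x \<in> perms. h x - \<mu> \<le> - t} \<le> fact CARD('n)"
    unfolding card_perms[symmetric] by (intro card_mono) auto
  then show ?thesis using True
    by (auto simp add: divide_le_eq) (metis of_nat_fact of_nat_le_iff)+
next
  case False
  then have t: "t > 0" using t by simp
  have "7.2 * d * C * \<mu> \<le> 4 / 5 * \<beta> * \<mu>"
    using \<beta> by (intro mult_right_mono mean_nonneg) (simp add: mult_ac)
  then have g: "7.2 * d * C * \<mu> \<le> \<gamma>" using \<gamma> by (rule order_trans)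
  have "7.2 * d * C * \<mu> \<ge> 0" using mean_nonneg d_pos C_pos by simp
  then have "\<gamma> \<ge> 0" using g by (rule order_trans)
  then have \<gamma>0: "\<gamma> > 0" using False by simp
  show ?thesis
  proof (cases "t \<le> \<mu>")
    case False
    then have empty: "{x \<in> perms. h x - \<mu> \<le> - t} = {}" using h_nonneg by fastforce
    show ?thesis unfolding empty by simp
  next
    case True
    \<comment> \<open>This minimises \<open>\<gamma> * s^2 / 2 - s * t\<close>; the case
      \<open>t \<le> \<mu>\<close> keeps it in the range of \<open>mgf_lower\<close>.\<close>
    define s where "s = t / \<gamma>"
    have s: "s > 0" using t \<gamma>0 by (simp add: s_def)
    have "7.2 * d * C * t \<le> 7.2 * d * C * \<mu>"
      using True d_pos C_pos by (intro mult_left_mono) auto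
    then have s1: "7.2 * d * C * s \<le> 1" using g \<gamma>0 by (simp add: s_def field_simps)
    have "{x \<in> perms. h x - \<mu> \<le> - t} = {x \<in> perms. - s * (h x - \<mu>) \<ge> s * t}"
      using s by (auto simp: mult_minus_right[symmetric] simp del: mult_minus_right)
    then have "real (card {x \<in> perms. h x - \<mu> \<le> - t}) * exp (s * t)
        \<le> fact CARD('n) * exp (7.2 * d * C * \<mu> * s\<^sup>2 / 2)"
      using chernoff[of "s * t" "- s"] mgf_lower[OF less_imp_le[OF s] s1 d] by simp
    also have "\<dots> \<le> fact CARD('n) * exp (\<gamma> * s\<^sup>2 / 2)"
      by (intro mult_left_mono iffD2[OF exp_le_cancel_iff] divide_right_mono mult_right_mono g) auto
    finally have "real (card {x \<in> perms. h x - \<mu> \<le> - t}) / fact CARD('n) \<le> exp (\<gamma> * s\<^sup>2 / 2 - s * t)"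
      unfolding exp_diff by (simp add: field_simps)
    also have "\<gamma> * s\<^sup>2 / 2 - s * t = - t\<^sup>2 / (2 * \<gamma>)"
      using \<gamma>0 by (simp add: s_def field_simps power2_eq_square)
    finally show ?thesis .
  qed
qed

end

section \<open>Polynomials and their derivatives at permutation matrices\<close>

definition monomial_matches :: "'n::finite monomial \<Rightarrow> ('n \<Rightarrow> 'n) \<Rightarrow> bool" where
  "monomial_matches m x \<longleftrightarrow> (\<forall>(i, j)\<in>Poly_Mapping.keys m. x i = j)"

text \<open>The line alters only an entry equal to 1, so an unmatched factor stays 0. Setting
  \<open>t = 0\<close> gives the value, differentiating at 0 the partial derivative.\<close>

lemma monomial_eval_line:
  "monomial_eval m (perm_matrix x + t *\<^sub>R matrix_unit i (x i))
    = of_bool (monomial_matches m x) * (1 + t) ^ Poly_Mapping.lookup m (i, x i)"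
proof -
  let ?M = "perm_matrix x + t *\<^sub>R matrix_unit i (x i)"
  let ?f = "\<lambda>ab. (?M $ fst ab $ snd ab) ^ Poly_Mapping.lookup m ab"
  have entry: "?M $ a $ b = (if x a = b then if a = i then 1 + t else 1 else 0)" for a b
    by (auto simp: perm_matrix_def matrix_unit_def axis_def)
  have ev: "monomial_eval m ?M = (\<Prod>ab\<in>Poly_Mapping.keys m. ?f ab)"
    by (simp add: monomial_eval_def case_prod_unfold)
  show ?thesis
  proof (cases "monomial_matches m x")
    case True
    have "(\<Prod>ab\<in>Poly_Mapping.keys m. ?f ab)
        = (\<Prod>ab\<in>Poly_Mapping.keys m. if ab = (i, x i) then (1 + t) ^ Poly_Mapping.lookup m (i, x i) else 1)"
      using True by (intro prod.cong refl) (auto simp: entry monomial_matches_def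
          simp del: vector_add_component vector_scaleR_component)
    then show ?thesis using True by (simp add: ev in_keys_iff)
  next
    case False
    then obtain a b where ab: "(a, b) \<in> Poly_Mapping.keys m" "x a \<noteq> b"
      by (auto simp: monomial_matches_def)
    then have zero: "?f (a, b) = 0"
      by (simp add: entry in_keys_iff del: vector_add_component vector_scaleR_component)
    then have "(\<Prod>ab\<in>Poly_Mapping.keys m. ?f ab) = 0"
      by (intro prod_zero finite_keys bexI[of _ "(a, b)"] zero ab(1))
    then show ?thesis using False by (simp add: ev)
  qed
qed

lemma polynomial_eval_perm_matrix:
  "polynomial_eval p (perm_matrix x)
    = (\<Sum>m\<in>Poly_Mapping.keys p. Poly_Mapping.lookup p m * of_bool (monomial_matches m x))"
  unfolding polynomial_eval_def using monomial_eval_line[of _ x 0] by simp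

lemma pd_polynomial_eval_perm_matrix:
  "pd i (x i) (polynomial_eval p) (perm_matrix x)
    = (\<Sum>m\<in>Poly_Mapping.keys p. Poly_Mapping.lookup p m *
        (of_bool (monomial_matches m x) * real (Poly_Mapping.lookup m (i, x i))))"
  unfolding pd_def polynomial_eval_def monomial_eval_line
  by (rule DERIV_imp_deriv) (auto intro!: derivative_eq_intros sum.cong)

lemma monomial_degree_matches:
  assumes "monomial_matches m x"
  shows "monomial_degree m = (\<Sum>i\<in>UNIV. Poly_Mapping.lookup m (i, x i))"
proof -
  have "monomial_degree m = (\<Sum>ij\<in>range (\<lambda>i. (i, x i)). Poly_Mapping.lookup m ij)"
    unfolding monomial_degree_def using assms
    by (intro sum.mono_neutral_left) (auto simp: monomial_matches_def in_keys_iff)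
  also have "\<dots> = (\<Sum>i\<in>UNIV. Poly_Mapping.lookup m (i, x i))"
    by (subst sum.reindex) (auto simp: inj_on_def)
  finally show ?thesis .
qed

text \<open>A swap can destroy a match only if the monomial uses \<open>(i, x i)\<close> or
  \<open>(k, x k)\<close>, and then the exponents on the right sum to at least 1.\<close>

lemma matches_swap_loss:
  "of_bool (monomial_matches m x) - of_bool (monomial_matches m (x \<circ> Transposition.transpose i k))
    \<le> of_bool (monomial_matches m x) *
        (real (Poly_Mapping.lookup m (i, x i)) + real (Poly_Mapping.lookup m (k, x k)))"
proof (cases "monomial_matches m x \<and> Poly_Mapping.lookup m (i, x i) = 0 \<and> Poly_Mapping.lookup m (k, x k) = 0")
  case True
  then have "monomial_matches m (x \<circ> Transposition.transpose i k)"
    by (fastforce simp: monomial_matches_def in_keys_iff Transposition.transpose_def)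
  then show ?thesis by simp
next
  case False
  then show ?thesis by (auto simp: of_bool_def)
qed

text \<open>Non-negative coefficients cannot cancel, so the growth of \<open>polynomial_eval p\<close> along
  \<open>c \<mapsto> c J\<close>, with \<open>J\<close> the all-ones matrix, bounds the degree of every monomial of \<open>p\<close>.\<close>

lemma monomial_degree_le_of_nonneg:
  fixes p q :: "'n::finite polynomial"
  assumes eq: "polynomial_eval p = polynomial_eval q"
    and nonneg: "\<And>m. Poly_Mapping.lookup p m \<ge> 0"
    and deg: "\<And>m. m \<in> Poly_Mapping.keys q \<Longrightarrow> monomial_degree m \<le> d"
    and m: "m \<in> Poly_Mapping.keys p"
  shows "monomial_degree m \<le> d"
proof (rule ccontr)
  assume "\<not> monomial_degree m \<le> d"
  then have dm: "Suc d \<le> monomial_degree m" by simp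
  define J :: "real^'n^'n" where "J = (\<chi> i j. 1)"
  have ev: "monomial_eval m' (c *\<^sub>R J) = c ^ monomial_degree m'" for m' c
    unfolding monomial_eval_scale by (simp add: monomial_eval_def J_def case_prod_unfold)
  define Q where "Q = (\<Sum>m\<in>Poly_Mapping.keys q. \<bar>Poly_Mapping.lookup q m\<bar>)"
  define a where "a = Poly_Mapping.lookup p m"
  define c where "c = Q / a + 1"
  have a: "a > 0" using m nonneg[of m] by (simp add: a_def in_keys_iff)
  have "Q \<ge> 0" by (simp add: Q_def sum_nonneg)
  then have c: "c \<ge> 1" using a by (simp add: c_def)
  have "a * c ^ Suc d \<le> a * c ^ monomial_degree m"
    using a c dm by (intro mult_left_mono power_increasing) auto
  also have "\<dots> \<le> polynomial_eval p (c *\<^sub>R J)"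
    unfolding polynomial_eval_def ev a_def using m c nonneg
    by (intro member_le_sum[where f = "\<lambda>m. Poly_Mapping.lookup p m * c ^ monomial_degree m"]) auto
  also have "\<dots> = polynomial_eval q (c *\<^sub>R J)" by (simp add: eq)
  also have "\<dots> \<le> (\<Sum>m\<in>Poly_Mapping.keys q. \<bar>Poly_Mapping.lookup q m\<bar> * c ^ d)"
    unfolding polynomial_eval_def ev using c deg
    by (intro sum_mono mult_mono power_increasing) auto
  also have "\<dots> = Q * c ^ d" by (simp add: Q_def sum_distrib_right)
  finally have "a * c * c ^ d \<le> Q * c ^ d" by (simp add: mult_ac)
  then have "a * c \<le> Q" using c by (simp add: mult_le_cancel_right)
  moreover have "a * c = Q + a" using a by (simp add: c_def field_simps)
  ultimately show False using a by simp
qed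

text \<open>The loss and Euler-type bounds hold monomial by monomial; non-negative coefficients let
  them be summed.\<close>

lemma swap_loss_polynomial_eval:
  fixes p :: "'n::finite polynomial"
  defines "\<phi> \<equiv> polynomial_eval p"
  assumes nonneg: "\<And>m. Poly_Mapping.lookup p m \<ge> 0"
    and deg: "\<And>m. m \<in> Poly_Mapping.keys p \<Longrightarrow> monomial_degree m \<le> d" and "d \<ge> 1"
    and grad: "grad_sup_norm \<phi> \<le> C" and "C > 0"
  shows "swap_loss (\<lambda>x. \<phi> (perm_matrix x)) (\<lambda>x i. pd i (x i) \<phi> (perm_matrix x)) C (real d)"
proof
  fix x :: "'n \<Rightarrow> 'n" and i k assume x: "x \<in> perms"
  show "\<phi> (perm_matrix x) \<ge> 0"
    unfolding \<phi>_def polynomial_eval_perm_matrix by (intro sum_nonneg mult_nonneg_nonneg nonneg) auto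
  show "pd i (x i) \<phi> (perm_matrix x) \<ge> 0"
    unfolding \<phi>_def pd_polynomial_eval_perm_matrix by (intro sum_nonneg mult_nonneg_nonneg nonneg) auto
  have "\<bar>pd i (x i) \<phi> (perm_matrix x)\<bar> \<le> grad_sup_norm \<phi>"
    unfolding grad_sup_norm_def
    by (intro Max_ge finite_imageI image_eqI[of _ _ "(x, i, x i)"]) (use x in auto)
  then show "pd i (x i) \<phi> (perm_matrix x) \<le> C" using grad by linarith
  show "\<phi> (perm_matrix x) - \<phi> (perm_matrix (x \<circ> Transposition.transpose i k))
      \<le> pd i (x i) \<phi> (perm_matrix x) + pd k (x k) \<phi> (perm_matrix x)"
    unfolding \<phi>_def pd_polynomial_eval_perm_matrix polynomial_eval_perm_matrix
      sum_subtractf[symmetric] sum.distrib[symmetric] right_diff_distrib[symmetric] distrib_left[symmetric]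
    by (intro sum_mono mult_left_mono matches_swap_loss nonneg)
  have "(\<Sum>i\<in>UNIV. pd i (x i) \<phi> (perm_matrix x))
      = (\<Sum>m\<in>Poly_Mapping.keys p. \<Sum>i\<in>UNIV. Poly_Mapping.lookup p m *
          (of_bool (monomial_matches m x) * real (Poly_Mapping.lookup m (i, x i))))"
    unfolding \<phi>_def pd_polynomial_eval_perm_matrix by (rule sum.swap)
  also have "\<dots> = (\<Sum>m\<in>Poly_Mapping.keys p. Poly_Mapping.lookup p m *
          (of_bool (monomial_matches m x) * real (monomial_degree m)))"
    by (intro sum.cong refl) (auto simp: sum_distrib_left[symmetric] of_bool_def monomial_degree_matches)
  also have "\<dots> \<le> (\<Sum>m\<in>Poly_Mapping.keys p. Poly_Mapping.lookup p m *
          (of_bool (monomial_matches m x) * real d))"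
    by (intro sum_mono mult_left_mono nonneg) (auto simp: deg)
  also have "\<dots> = real d * \<phi> (perm_matrix x)"
    unfolding \<phi>_def polynomial_eval_perm_matrix sum_distrib_left by (intro sum.cong refl) (simp only: mult_ac)
  finally show "(\<Sum>i\<in>UNIV. pd i (x i) \<phi> (perm_matrix x)) \<le> real d * \<phi> (perm_matrix x)" .
qed (use assms in auto)

section \<open>Passage to probabilities and conclusion\<close>

lemma perms_nonempty: "perms \<noteq> {}"
proof -
  have "id \<in> perms" by (simp add: permutes_id)
  then show ?thesis by blast
qed

lemma mean_eq_perm_mean: "mean \<phi> = perm_mean (\<lambda>x. \<phi> (perm_matrix x))"
  unfolding mean_def unif_perm_def perm_mean_def
  by (subst integral_pmf_of_set) (auto simp: perms_nonempty[simplified] card_perms)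

lemma prob_unif_perm:
  "measure_pmf.prob unif_perm {x :: 'n::finite \<Rightarrow> 'n. P x} = real (card {x \<in> perms. P x}) / fact CARD('n)"
  unfolding unif_perm_def
  by (subst measure_pmf_of_set) (auto simp: perms_nonempty[simplified] card_perms Collect_conj_eq[symmetric])

text \<open>Both \<open>1 - exp (- 2 / n) \<le> 2 / n\<close> and
  \<open>2 - exp (- 2 / n) \<ge> 1\<close> hold.\<close>

lemma geometric_factor_ge_1:
  fixes n :: real
  assumes "n > 0"
  shows "(2 / n) * (2 - exp (- 2 / n)) / (1 - exp (- 2 / n)) \<ge> 1"
proof -
  have e: "exp (- 2 / n) < 1" "1 - 2 / n \<le> exp (- 2 / n)"
    using assms exp_ge_add_one_self[of "- 2 / n"] by auto
  have "1 - exp (- 2 / n) \<le> 2 / n * 1" using e by simp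
  also have "\<dots> \<le> 2 / n * (2 - exp (- 2 / n))"
    using assms e by (intro mult_left_mono) auto
  finally show ?thesis using e(1) by (simp only: le_divide_eq_1_pos diff_gt_0_iff_gt)
qed

theorem theorem1p2:
  fixes \<phi> :: "real^'n::finite^'n \<Rightarrow> real" and d :: nat and C\<^sub>D C\<^sub>D' C\<^sub>U :: real
  assumes "d \<in> {1..CARD('n)}"
    and "\<phi> \<in> FF_le d" and "has_degree \<phi> d" and "nonneg_coeffs \<phi>"
    and "C\<^sub>D \<ge> 0" and "C\<^sub>D' \<ge> 0" and "C\<^sub>U \<ge> 0"
    and "\<And>k. k \<in> {0..d} \<Longrightarrow> sup_norm ((D_op ^^ k) \<phi>) \<le> C\<^sub>D"
    and "\<And>k. k \<in> {0..d} \<Longrightarrow> grad_sup_norm ((D_op ^^ k) \<phi>) \<le> C\<^sub>D'"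
    and "\<And>k. k \<in> {0..d} \<Longrightarrow> sup_norm ((D_op ^^ k) (U_op \<phi>)) \<le> C\<^sub>U"
  shows "let n = real CARD('n);
             \<beta> = 9 * real d * C\<^sub>D' *
                 (max 0 (ln (4 * C\<^sub>D * n / C\<^sub>D')) +
                  (2 / n) * (2 - exp (- 2 / n)) / (1 - exp (- 2 / n)));
             \<gamma> = 2 * \<beta> / 5 * (2 * mean \<phi> + C\<^sub>U)
         in \<forall>t\<ge>0.
              measure_pmf.prob unif_perm {\<sigma>. \<phi> (perm_matrix \<sigma>) - mean \<phi> \<ge> t}
                \<le> exp (- t\<^sup>2 / (2 * (\<gamma> + \<beta> * t))) \<and>
              measure_pmf.prob unif_perm {\<sigma>. \<phi> (perm_matrix \<sigma>) - mean \<phi> \<le> - t}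
                \<le> exp (- t\<^sup>2 / (2 * \<gamma>))"
proof -
  let ?n = "real CARD('n)"
  define \<beta> where "\<beta> = 9 * real d * C\<^sub>D' *
                 (max 0 (ln (4 * C\<^sub>D * ?n / C\<^sub>D')) +
                  (2 / ?n) * (2 - exp (- 2 / ?n)) / (1 - exp (- 2 / ?n)))"
  define \<gamma> where "\<gamma> = 2 * \<beta> / 5 * (2 * mean \<phi> + C\<^sub>U)"
  have "measure_pmf.prob unif_perm {\<sigma>. \<phi> (perm_matrix \<sigma>) - mean \<phi> \<ge> t}
          \<le> exp (- t\<^sup>2 / (2 * (\<gamma> + \<beta> * t)))" (is ?U)
    and "measure_pmf.prob unif_perm {\<sigma>. \<phi> (perm_matrix \<sigma>) - mean \<phi> \<le> - t}
          \<le> exp (- t\<^sup>2 / (2 * \<gamma>))" (is ?L) if t: "t \<ge> 0" for t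
  proof -
    have "?U \<and> ?L"
    proof (cases "C\<^sub>D' = 0")
      case True
      \<comment> \<open>Here \<open>\<beta>\<close> and \<open>\<gamma>\<close> vanish, and division
        by zero turns both bounds into 1.\<close>
      then show ?thesis by (simp add: \<beta>_def \<gamma>_def)
    next
      case False
      then have C: "C\<^sub>D' > 0" using assms(6) by simp
      have d: "d \<ge> 1" using assms(1) by simp
      obtain p where p: "\<phi> = polynomial_eval p" "\<And>m. Poly_Mapping.lookup p m \<ge> 0"
        using assms(4) by (auto simp: nonneg_coeffs_def)
      obtain q where q: "\<phi> = polynomial_eval q" "Max (monomial_degree ` Poly_Mapping.keys q) = d"
        using assms(3) by (auto simp: has_degree_def)
      \<comment> \<open>The degree and the signs come with separate representing polynomials, so the
        degree bound is carried from \<open>q\<close> to \<open>p\<close>.\<close>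
      have deg: "monomial_degree m \<le> d" if "m \<in> Poly_Mapping.keys p" for m
      proof (rule monomial_degree_le_of_nonneg[OF _ p(2) _ that])
        show "polynomial_eval p = polynomial_eval q" using p(1) q(1) by simp
        show "monomial_degree m' \<le> d" if "m' \<in> Poly_Mapping.keys q" for m'
          unfolding q(2)[symmetric] using that by (intro Max_ge) auto
      qed
      have grad: "grad_sup_norm \<phi> \<le> C\<^sub>D'" using assms(9)[of 0] by simp
      interpret swap_loss "\<lambda>x. \<phi> (perm_matrix x)" "\<lambda>x i. pd i (x i) \<phi> (perm_matrix x)" C\<^sub>D' "real d"
        using swap_loss_polynomial_eval[OF p(2) deg d, of C\<^sub>D'] C grad by (simp add: p(1))
      have "9 * real d * C\<^sub>D' * 1 \<le> \<beta>"
        unfolding \<beta>_def using geometric_factor_ge_1[of ?n] C by (intro mult_left_mono add_increasing) auto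
      then have \<beta>: "9 * real d * C\<^sub>D' \<le> \<beta>" by simp
      moreover have "9 * real d * C\<^sub>D' \<ge> 0" using C by simp
      ultimately have "\<beta> \<ge> 0" by linarith
      then have \<gamma>: "4 / 5 * \<beta> * perm_mean (\<lambda>x. \<phi> (perm_matrix x)) \<le> \<gamma>"
        using assms(7) by (simp add: \<gamma>_def mean_eq_perm_mean algebra_simps)
      show ?thesis
        unfolding prob_unif_perm mean_eq_perm_mean
        using upper_tail[OF t \<beta> \<gamma>] lower_tail[OF t _ \<beta> \<gamma>] d by simp
    qed
    then show ?U ?L by auto
  qed
  then show ?thesis unfolding Let_def \<beta>_def \<gamma>_def by blast
qed

end
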